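(* Let $(V,l_V,r_V,T_V)$ be a representation of a Rota-Baxter Leibniz algebra $(\mathfrak{g}_T,[\,,\,]_{\mathfrak{g}})$. Let $V^*$ be the dual vector space of $V$ and define $l_{V^*}:\mathfrak{g}\otimes V^*\to V^*$ and $r_{V^*}:V^*\otimes\mathfrak{g}\to V^*$ by $$l_{V^*}(x,f_V)(u)=-f_V(l_V(x,u)),\qquad r_{V^*}(f_V,x)(u)=f_V\big(l_V(x,u)+r_V(u,x)\big)$$ for all $x\in\mathfrak{g}$, $f_V\in V^*$, $u\in V$. Let $T_V^*:V^*\to V^*$, $T_V^*(f_V)=f_V\circ T_V$, be the dual map of $T_V$. Then $(V^*,l_{V^*},r_{V^*},-T_V^* )$ is a representation of the Rota-Baxter Leibniz algebra $(\mathfrak{g}_T,[\,,\,]_{\mathfrak{g}})$.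
   Context: All vector spaces are over a fixed field. A (left) Leibniz algebra is a vector space $\mathfrak{g}$ with a bilinear bracket $[\,,\,]_{\mathfrak{g}}$ satisfying $[x,[y,z]_{\mathfrak{g}}]_{\mathfrak{g}}=[[x,y]_{\mathfrak{g}},z]_{\mathfrak{g}}+[y,[x,z]_{\mathfrak{g}}]_{\mathfrak{g}}$. A Rota-Baxter operator on it is a linear map $T:\mathfrak{g}\to\mathfrak{g}$ with $[T(x),T(y)]_{\mathfrak{g}}=T([T(x),y]_{\mathfrak{g}}+[x,T(y)]_{\mathfrak{g}})$ for all $x,y$. A Rota-Baxter Leibniz algebra $(\mathfrak{g}_T,[\,,\,]_{\mathfrak{g}})$ is a Leibniz algebra together with a Rota-Baxter operator $T$. A representation of a Leibniz algebra $(\mathfrak{g},[\,,\,]_{\mathfrak{g}})$ is $(V,l_V,r_V)$ with $V$ a vector space and bilinear maps $l_V:\mathfrak{g}\otimes V\to V$, $r_V:V\otimes\mathfrak{g}\to V$ such that for all $x,y\in\mathfrak{g}$, $u\in V$: (1) $l_V(x,l_V(y,u))=l_V([x,y]_{\mathfrak{g}},u)+l_V(y,l_V(x,u))$; (2) $l_V(x,r_V(u,y))=r_V(l_V(x,u),y)+r_V(u,[x,y]_{\mathfrak{g}})$; (3) $r_V(u,[x,y]_{\mathfrak{g}})=r_V(r_V(u,x),y)+l_V(x,r_V(u,y))$. A representation of a Rota-Baxter Leibniz algebra $(\mathfrak{g}_T,[\,,\,]_{\mathfrak{g}})$ is $(V,l_V,r_V,T_V)$ where $(V,l_V,r_V)$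 is a representation of $(\mathfrak{g},[\,,\,]_{\mathfrak{g}})$ and $T_V:V\to V$ is linear with, for all $x\in\mathfrak{g}$, $u\in V$: $l_V(T(x),T_V(u))=T_V(l_V(T(x),u)+l_V(x,T_V(u)))$ and $r_V(T_V(u),T(x))=T_V(r_V(T_V(u),x)+r_V(u,T(x)))$. *)

theory Defs
  imports "HOL-Algebra.Module"
begin

section \<open>Vector spaces and linear maps\<close>

locale vectorspace = field K + module K V for K (structure) and V (structure)

definition linear_maps ::
    "('k, 'a) ring_scheme \<Rightarrow> ('k, 'u, 'b) module_scheme \<Rightarrow> ('k, 'v, 'c) module_scheme \<Rightarrow> ('u \<Rightarrow> 'v) set"
  where "linear_maps K U V =
    {f \<in> carrier U \<rightarrow> carrier V.
      (\<forall>x \<in> carrier U. \<forall>y \<in> carrier U. f (x \<oplus>\<^bsub>U\<^esub> y) = f x \<oplus>\<^bsub>V\<^esub> f y) \<and>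
      (\<forall>a \<in> carrier K. \<forall>x \<in> carrier U. f (a \<odot>\<^bsub>U\<^esub> x) = a \<odot>\<^bsub>V\<^esub> f x)}"

text \<open>Bilinear maps are curried, so a linear map on a tensor product \<open>U \<otimes> V\<close> is represented by the
  corresponding bilinear map.\<close>

definition bilinear_maps ::
    "('k, 'a) ring_scheme \<Rightarrow> ('k, 'u, 'b) module_scheme \<Rightarrow> ('k, 'v, 'c) module_scheme
      \<Rightarrow> ('k, 'w, 'd) module_scheme \<Rightarrow> ('u \<Rightarrow> 'v \<Rightarrow> 'w) set"
  where "bilinear_maps K U V W =
    {b. (\<forall>x \<in> carrier U. (\<lambda>y. b x y) \<in> linear_maps K V W) \<and>
        (\<forall>y \<in> carrier V. (\<lambda>x. b x y) \<in> linear_maps K U W)}"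


section \<open>Leibniz algebras, Rota-Baxter operators and representations\<close>

locale leibniz_algebra = vectorspace K G for K (structure) and G (structure) +
  fixes bracket :: "'c \<Rightarrow> 'c \<Rightarrow> 'c"
  assumes bracket_bilinear: "bracket \<in> bilinear_maps K G G G"
    and left_leibniz: "\<And>x y z. \<lbrakk>x \<in> carrier G; y \<in> carrier G; z \<in> carrier G\<rbrakk> \<Longrightarrow>
      bracket x (bracket y z) = bracket (bracket x y) z \<oplus>\<^bsub>G\<^esub> bracket y (bracket x z)"

locale rota_baxter_leibniz_algebra = leibniz_algebra K G bracket
  for K (structure) and G (structure) and bracket +
  fixes T :: "'c \<Rightarrow> 'c"
  assumes T_linear: "T \<in> linear_maps K G G"
    and rota_baxter: "\<And>x y. \<lbrakk>x \<in> carrier G; y \<in> carrier G\<rbrakk> \<Longrightarrow>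
      bracket (T x) (T y) = T (bracket (T x) y \<oplus>\<^bsub>G\<^esub> bracket x (T y))"

locale leibniz_representation = leibniz_algebra K G bracket + V: vectorspace K V
  for K (structure) and G (structure) and bracket and V (structure) +
  fixes l :: "'c \<Rightarrow> 'e \<Rightarrow> 'e" and r :: "'e \<Rightarrow> 'c \<Rightarrow> 'e"
  assumes l_bilinear: "l \<in> bilinear_maps K G V V"
    and r_bilinear: "r \<in> bilinear_maps K V G V"
    and rep_ll: "\<And>x y u. \<lbrakk>x \<in> carrier G; y \<in> carrier G; u \<in> carrier V\<rbrakk> \<Longrightarrow>
      l x (l y u) = l (bracket x y) u \<oplus>\<^bsub>V\<^esub> l y (l x u)"
    and rep_lr: "\<And>x y u. \<lbrakk>x \<in> carrier G; y \<in> carrier G; u \<in> carrier V\<rbrakk> \<Longrightarrow>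
      l x (r u y) = r (l x u) y \<oplus>\<^bsub>V\<^esub> r u (bracket x y)"
    and rep_rr: "\<And>x y u. \<lbrakk>x \<in> carrier G; y \<in> carrier G; u \<in> carrier V\<rbrakk> \<Longrightarrow>
      r u (bracket x y) = r (r u x) y \<oplus>\<^bsub>V\<^esub> l x (r u y)"

locale rota_baxter_leibniz_representation =
  rota_baxter_leibniz_algebra K G bracket T + leibniz_representation K G bracket V l r
  for K (structure) and G (structure) and bracket and T and V (structure) and l and r +
  fixes TV :: "'e \<Rightarrow> 'e"
  assumes TV_linear: "TV \<in> linear_maps K V V"
    and rota_baxter_l: "\<And>x u. \<lbrakk>x \<in> carrier G; u \<in> carrier V\<rbrakk> \<Longrightarrow>
      l (T x) (TV u) = TV (l (T x) u \<oplus>\<^bsub>V\<^esub> l x (TV u))"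
    and rota_baxter_r: "\<And>x u. \<lbrakk>x \<in> carrier G; u \<in> carrier V\<rbrakk> \<Longrightarrow>
      r (TV u) (T x) = TV (r (TV u) x \<oplus>\<^bsub>V\<^esub> r u (T x))"


section \<open>The dual vector space\<close>

definition scalar_space :: "('k, 'a) ring_scheme \<Rightarrow> ('k, 'k) module"
  where "scalar_space K =
    \<lparr>carrier = carrier K, mult = mult K, one = one K, zero = zero K, add = add K, smult = mult K\<rparr>"

text \<open>Functionals are taken to be extensional (undefined outside \<open>carrier V\<close>), so that two of them
  are equal as soon as they agree on \<open>carrier V\<close>. The fields \<open>mult\<close> and \<open>one\<close>, which the module
  record inherits from the ring record, play no role in the vector space structure.\<close>

definition dual_space :: "('k, 'a) ring_scheme \<Rightarrow> ('k, 'v, 'b) module_scheme \<Rightarrow> ('k, 'v \<Rightarrow> 'k) module"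
  where "dual_space K V =
    \<lparr>carrier = linear_maps K V (scalar_space K) \<inter> extensional (carrier V),
     mult = undefined,
     one = undefined,
     zero = (\<lambda>u \<in> carrier V. \<zero>\<^bsub>K\<^esub>),
     add = (\<lambda>f g. \<lambda>u \<in> carrier V. f u \<oplus>\<^bsub>K\<^esub> g u),
     smult = (\<lambda>a f. \<lambda>u \<in> carrier V. a \<otimes>\<^bsub>K\<^esub> f u)\<rparr>"

definition dual_map :: "('k, 'v, 'b) module_scheme \<Rightarrow> ('v \<Rightarrow> 'v) \<Rightarrow> ('v \<Rightarrow> 'k) \<Rightarrow> ('v \<Rightarrow> 'k)"
  where "dual_map V S f = compose (carrier V) f S"

definition dual_l ::
    "('k, 'a) ring_scheme \<Rightarrow> ('k, 'v, 'b) module_scheme \<Rightarrow> ('g \<Rightarrow> 'v \<Rightarrow> 'v)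
      \<Rightarrow> 'g \<Rightarrow> ('v \<Rightarrow> 'k) \<Rightarrow> ('v \<Rightarrow> 'k)"
  where "dual_l K V l x f = (\<lambda>u \<in> carrier V. \<ominus>\<^bsub>K\<^esub> f (l x u))"

definition dual_r ::
    "('k, 'a) ring_scheme \<Rightarrow> ('k, 'v, 'b) module_scheme \<Rightarrow> ('g \<Rightarrow> 'v \<Rightarrow> 'v) \<Rightarrow> ('v \<Rightarrow> 'g \<Rightarrow> 'v)
      \<Rightarrow> ('v \<Rightarrow> 'k) \<Rightarrow> 'g \<Rightarrow> ('v \<Rightarrow> 'k)"
  where "dual_r K V l r f x = (\<lambda>u \<in> carrier V. f (l x u \<oplus>\<^bsub>V\<^esub> r u x))"

end

theory Submission
  imports Defs
begin

text \<open>An identity between functionals is tested at each vector \<open>u\<close>, where it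
  becomes an identity in the field between values of \<open>f\<close>. This follows by applying
  \<open>f\<close> to axioms of the given representation.

  Write l* and r* for the dual actions. Axiom (1) for the dual comes from \<open>rep_ll\<close>,
  axiom (2) from \<open>rep_ll\<close> together with \<open>rep_lr\<close>. In axiom (3), expanding
  r*(r*(f,x),y) at \<open>u\<close> also produces \<open>f\<close> of r(l(y,u),x) + r(r(u,y),x).
  This sum vanishes by \<open>r_l_plus_r_r\<close>, and the remaining terms are again those of
  \<open>rep_ll\<close> and \<open>rep_lr\<close>.

  The minus sign of the operator is forced by the Rota-Baxter identity l(Tx,TV u) = TV(l(Tx,u)) +
  TV(l(x,TV u)). Transposing exchanges the roles of l(Tx,TV u) and TV(l(Tx,u)), so the last term
  must change sign. It is the only one of the three that is quadratic in \<open>TV\<close>, and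
  replacing the dual map by its negative has exactly this effect. The condition on r* is the sum of
  the conditions on l and r, since r* is built from l + r.\<close>

lemma linear_mapsI:
  assumes "\<And>x. x \<in> carrier U \<Longrightarrow> f x \<in> carrier V"
    and "\<And>x y. \<lbrakk>x \<in> carrier U; y \<in> carrier U\<rbrakk> \<Longrightarrow> f (x \<oplus>\<^bsub>U\<^esub> y) = f x \<oplus>\<^bsub>V\<^esub> f y"
    and "\<And>a x. \<lbrakk>a \<in> carrier K; x \<in> carrier U\<rbrakk> \<Longrightarrow> f (a \<odot>\<^bsub>U\<^esub> x) = a \<odot>\<^bsub>V\<^esub> f x"
  shows "f \<in> linear_maps K U V"
  using assms by (auto simp: linear_maps_def)

lemma linear_mapsD:
  assumes "f \<in> linear_maps K U V"
  shows "x \<in> carrier U \<Longrightarrow> f x \<in> carrier V"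
    and "\<lbrakk>x \<in> carrier U; y \<in> carrier U\<rbrakk> \<Longrightarrow> f (x \<oplus>\<^bsub>U\<^esub> y) = f x \<oplus>\<^bsub>V\<^esub> f y"
    and "\<lbrakk>a \<in> carrier K; x \<in> carrier U\<rbrakk> \<Longrightarrow> f (a \<odot>\<^bsub>U\<^esub> x) = a \<odot>\<^bsub>V\<^esub> f x"
  using assms by (auto simp: linear_maps_def)

lemma bilinear_mapsI:
  assumes "\<And>x y. \<lbrakk>x \<in> carrier U; y \<in> carrier V\<rbrakk> \<Longrightarrow> b x y \<in> carrier W"
    and "\<And>x y z. \<lbrakk>x \<in> carrier U; y \<in> carrier V; z \<in> carrier V\<rbrakk> \<Longrightarrow>
      b x (y \<oplus>\<^bsub>V\<^esub> z) = b x y \<oplus>\<^bsub>W\<^esub> b x z"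
    and "\<And>a x y. \<lbrakk>a \<in> carrier K; x \<in> carrier U; y \<in> carrier V\<rbrakk> \<Longrightarrow>
      b x (a \<odot>\<^bsub>V\<^esub> y) = a \<odot>\<^bsub>W\<^esub> b x y"
    and "\<And>x y z. \<lbrakk>x \<in> carrier U; y \<in> carrier U; z \<in> carrier V\<rbrakk> \<Longrightarrow>
      b (x \<oplus>\<^bsub>U\<^esub> y) z = b x z \<oplus>\<^bsub>W\<^esub> b y z"
    and "\<And>a x y. \<lbrakk>a \<in> carrier K; x \<in> carrier U; y \<in> carrier V\<rbrakk> \<Longrightarrow>
      b (a \<odot>\<^bsub>U\<^esub> x) y = a \<odot>\<^bsub>W\<^esub> b x y"
  shows "b \<in> bilinear_maps K U V W"
  using assms by (auto simp: bilinear_maps_def intro!: linear_mapsI)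

lemma bilinear_mapsD:
  assumes "b \<in> bilinear_maps K U V W"
  shows "\<lbrakk>x \<in> carrier U; y \<in> carrier V\<rbrakk> \<Longrightarrow> b x y \<in> carrier W"
    and "\<lbrakk>x \<in> carrier U; y \<in> carrier V; z \<in> carrier V\<rbrakk> \<Longrightarrow>
      b x (y \<oplus>\<^bsub>V\<^esub> z) = b x y \<oplus>\<^bsub>W\<^esub> b x z"
    and "\<lbrakk>a \<in> carrier K; x \<in> carrier U; y \<in> carrier V\<rbrakk> \<Longrightarrow>
      b x (a \<odot>\<^bsub>V\<^esub> y) = a \<odot>\<^bsub>W\<^esub> b x y"
    and "\<lbrakk>x \<in> carrier U; x' \<in> carrier U; y \<in> carrier V\<rbrakk> \<Longrightarrow>
      b (x \<oplus>\<^bsub>U\<^esub> x') y = b x y \<oplus>\<^bsub>W\<^esub> b x' y"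
    and "\<lbrakk>a \<in> carrier K; x \<in> carrier U; y \<in> carrier V\<rbrakk> \<Longrightarrow>
      b (a \<odot>\<^bsub>U\<^esub> x) y = a \<odot>\<^bsub>W\<^esub> b x y"
  using assms unfolding bilinear_maps_def linear_maps_def by auto

section \<open>The dual vector space\<close>

lemma dual_space_carrierI:
  assumes "\<And>u. u \<in> carrier V \<Longrightarrow> f u \<in> carrier K"
    and "\<And>u v. \<lbrakk>u \<in> carrier V; v \<in> carrier V\<rbrakk> \<Longrightarrow> f (u \<oplus>\<^bsub>V\<^esub> v) = f u \<oplus>\<^bsub>K\<^esub> f v"
    and "\<And>a u. \<lbrakk>a \<in> carrier K; u \<in> carrier V\<rbrakk> \<Longrightarrow> f (a \<odot>\<^bsub>V\<^esub> u) = a \<otimes>\<^bsub>K\<^esub> f u"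
    and "f \<in> extensional (carrier V)"
  shows "f \<in> carrier (dual_space K V)"
  using assms by (auto simp: dual_space_def scalar_space_def intro!: linear_mapsI)

lemma dual_space_carrierD:
  assumes "f \<in> carrier (dual_space K V)"
  shows "u \<in> carrier V \<Longrightarrow> f u \<in> carrier K"
    and "\<lbrakk>u \<in> carrier V; v \<in> carrier V\<rbrakk> \<Longrightarrow> f (u \<oplus>\<^bsub>V\<^esub> v) = f u \<oplus>\<^bsub>K\<^esub> f v"
    and "\<lbrakk>a \<in> carrier K; u \<in> carrier V\<rbrakk> \<Longrightarrow> f (a \<odot>\<^bsub>V\<^esub> u) = a \<otimes>\<^bsub>K\<^esub> f u"
    and "f \<in> extensional (carrier V)"
  using assms unfolding dual_space_def scalar_space_def linear_maps_def by auto

text \<open>Both functionals are \<open>undefined\<close> off \<open>carrier V\<close>, so agreement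
  on the carrier is agreement everywhere. This is the passage from equations of functionals to
  equations in the field.\<close>

lemma dual_space_eqI:
  assumes "f \<in> carrier (dual_space K V)" "g \<in> carrier (dual_space K V)"
    and "\<And>u. u \<in> carrier V \<Longrightarrow> f u = g u"
  shows "f = g"
  using extensionalityI[of f "carrier V" g] assms dual_space_carrierD(4) by blast

lemma dual_space_apply:
  assumes "u \<in> carrier V"
  shows "(f \<oplus>\<^bsub>dual_space K V\<^esub> g) u = f u \<oplus>\<^bsub>K\<^esub> g u"
    and "(a \<odot>\<^bsub>dual_space K V\<^esub> f) u = a \<otimes>\<^bsub>K\<^esub> f u"
    and "\<zero>\<^bsub>dual_space K V\<^esub> u = \<zero>\<^bsub>K\<^esub>"
  using assms by (auto simp: dual_space_def)

lemma dual_space_extensional: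
  "f \<oplus>\<^bsub>dual_space K V\<^esub> g \<in> extensional (carrier V)"
  "a \<odot>\<^bsub>dual_space K V\<^esub> f \<in> extensional (carrier V)"
  "\<zero>\<^bsub>dual_space K V\<^esub> \<in> extensional (carrier V)"
  by (auto simp: dual_space_def)

context vectorspace
begin

lemma dual_add_closed:
  assumes f: "f \<in> carrier (dual_space K V)" and g: "g \<in> carrier (dual_space K V)"
  shows "f \<oplus>\<^bsub>dual_space K V\<^esub> g \<in> carrier (dual_space K V)"
  by (rule dual_space_carrierI)
    (auto simp: dual_space_apply dual_space_extensional
      dual_space_carrierD[OF f] dual_space_carrierD[OF g] cring_simprules)

lemma dual_smult_closed:
  assumes f: "f \<in> carrier (dual_space K V)" and a: "a \<in> carrier K"
  shows "a \<odot>\<^bsub>dual_space K V\<^esub> f \<in> carrier (dual_space K V)"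
  by (rule dual_space_carrierI)
    (auto simp: dual_space_apply dual_space_extensional dual_space_carrierD[OF f] a m_ac r_distr)

lemma dual_zero_closed: "\<zero>\<^bsub>dual_space K V\<^esub> \<in> carrier (dual_space K V)"
  by (rule dual_space_carrierI) (auto simp: dual_space_apply dual_space_extensional)

lemma dual_neg_closed:
  assumes f: "f \<in> carrier (dual_space K V)"
  shows "(\<lambda>u \<in> carrier V. \<ominus> f u) \<in> carrier (dual_space K V)"
  by (rule dual_space_carrierI) (auto simp: dual_space_carrierD[OF f] cring_simprules)

text \<open>Serves twice: it supplies the inverses for the group structure, and it later identifies
  the abstract negation of the dual space.\<close>

lemma dual_l_neg:
  assumes f: "f \<in> carrier (dual_space K V)"
  shows "(\<lambda>u \<in> carrier V. \<ominus> f u) \<oplus>\<^bsub>dual_space K V\<^esub> f = \<zero>\<^bsub>dual_space K V\<^esub>"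
  by (rule dual_space_eqI[OF dual_add_closed[OF dual_neg_closed[OF f] f] dual_zero_closed])
    (auto simp: dual_space_apply dual_space_carrierD[OF f] cring_simprules)

lemma dual_space_vectorspace: "vectorspace K (dual_space K V)"
proof -
  interpret D: abelian_group "dual_space K V"
  proof (rule abelian_groupI)
    fix f assume f: "f \<in> carrier (dual_space K V)"
    from dual_neg_closed[OF f] dual_l_neg[OF f]
    show "\<exists>g \<in> carrier (dual_space K V). g \<oplus>\<^bsub>dual_space K V\<^esub> f = \<zero>\<^bsub>dual_space K V\<^esub>" by blast
  qed (auto intro!: dual_space_eqI dual_add_closed dual_zero_closed
      simp: dual_space_apply dual_space_carrierD cring_simprules)
  show ?thesis
    by (intro vectorspace.intro module.intro module_axioms.intro
        field_axioms is_cring D.abelian_group_axioms)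
      (auto intro!: dual_space_eqI dual_add_closed dual_smult_closed
        simp: dual_space_apply dual_space_carrierD l_distr r_distr m_assoc)
qed

text \<open>Negation in \<open>dual_space K V\<close> is determined only by the additive structure;
  uniqueness of inverses turns it into a pointwise formula.\<close>

lemma dual_a_inv:
  assumes f: "f \<in> carrier (dual_space K V)"
  shows "\<ominus>\<^bsub>dual_space K V\<^esub> f = (\<lambda>u \<in> carrier V. \<ominus> f u)"
proof -
  interpret D: vectorspace K "dual_space K V" by (rule dual_space_vectorspace)
  show ?thesis
    using D.M.minus_equality f dual_neg_closed dual_l_neg by blast
qed

lemma dual_map_closed:
  assumes S: "S \<in> linear_maps K V V" and f: "f \<in> carrier (dual_space K V)"
  shows "dual_map V S f \<in> carrier (dual_space K V)"
  by (rule dual_space_carrierI)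
    (auto simp: dual_map_def compose_def dual_space_carrierD[OF f] linear_mapsD[OF S])

end

section \<open>The dual Leibniz representation\<close>

context leibniz_representation
begin

lemma dual_l_closed:
  assumes x: "x \<in> carrier G" and f: "f \<in> carrier (dual_space K V)"
  shows "dual_l K V l x f \<in> carrier (dual_space K V)"
  by (rule dual_space_carrierI)
    (auto simp: dual_l_def dual_space_carrierD[OF f] bilinear_mapsD[OF l_bilinear] x
      cring_simprules)

lemma dual_r_closed:
  assumes x: "x \<in> carrier G" and f: "f \<in> carrier (dual_space K V)"
  shows "dual_r K V l r f x \<in> carrier (dual_space K V)"
  by (rule dual_space_carrierI)
    (auto simp: dual_r_def dual_space_carrierD[OF f] x cring_simprules
      bilinear_mapsD[OF l_bilinear] bilinear_mapsD[OF r_bilinear])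

text \<open>Axioms (2) and (3) for the pair \<open>(y, x)\<close> make the two terms of
  \<open>r\<^bsub>V\<^sup>*\<^esub>(r\<^bsub>V\<^sup>*\<^esub>(f, x), y)\<close> with an outer \<open>r(_, x)\<close> cancel.\<close>
lemma r_l_plus_r_r:
  assumes "x \<in> carrier G" "y \<in> carrier G" "u \<in> carrier V"
  shows "r (l y u) x \<oplus>\<^bsub>V\<^esub> r (r u y) x = \<zero>\<^bsub>V\<^esub>"
proof -
  note cl = bilinear_mapsD(1)[OF l_bilinear] bilinear_mapsD(1)[OF r_bilinear]
    bilinear_mapsD(1)[OF bracket_bilinear] assms
  \<comment> \<open>In \<open>rep_lr\<close> for the pair (y, x), the term
    \<open>r u (bracket y x)\<close> is expanded by \<open>rep_rr\<close>. Then
    \<open>l y (r u x)\<close> stands on both sides and cancels.\<close>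
  have "l y (r u x) = r (l y u) x \<oplus>\<^bsub>V\<^esub> (r (r u y) x \<oplus>\<^bsub>V\<^esub> l y (r u x))"
    using rep_lr[of y x u] rep_rr[of y x u] assms by simp
  also have "\<dots> = (r (l y u) x \<oplus>\<^bsub>V\<^esub> r (r u y) x) \<oplus>\<^bsub>V\<^esub> l y (r u x)"
    by (simp add: cl V.M.a_assoc)
  finally show ?thesis
    by (metis V.M.add.l_cancel_one V.M.a_comm V.M.add.m_closed cl)
qed

lemma dual_leibniz_representation:
  "leibniz_representation K G bracket (dual_space K V) (dual_l K V l) (dual_r K V l r)"
proof -
  note cl = bilinear_mapsD(1)[OF l_bilinear] bilinear_mapsD(1)[OF r_bilinear]
    bilinear_mapsD(1)[OF bracket_bilinear]
  note lin = bilinear_mapsD(2-)[OF l_bilinear] bilinear_mapsD(2-)[OF r_bilinear]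
  note dcl = dual_l_closed dual_r_closed V.dual_add_closed V.dual_smult_closed
  note dual_defs = dual_l_def dual_r_def dual_space_apply
  show ?thesis
  proof (intro leibniz_representation.intro leibniz_representation_axioms.intro
      leibniz_algebra_axioms V.dual_space_vectorspace)
    show "dual_l K V l \<in> bilinear_maps K G (dual_space K V) (dual_space K V)"
      by (intro bilinear_mapsI dual_space_eqI[where K = K and V = V] dcl)
        (auto simp: dual_defs cl lin dual_space_carrierD cring_simprules)
    show "dual_r K V l r \<in> bilinear_maps K (dual_space K V) G (dual_space K V)"
      by (intro bilinear_mapsI dual_space_eqI[where K = K and V = V] dcl)
        (auto simp: dual_defs cl lin dual_space_carrierD cring_simprules)
  next
    fix x y f assume x: "x \<in> carrier G" and y: "y \<in> carrier G"
      and f: "f \<in> carrier (dual_space K V)"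
    note fs = dual_space_carrierD[OF f]
    show "dual_l K V l x (dual_l K V l y f) =
      dual_l K V l (bracket x y) f \<oplus>\<^bsub>dual_space K V\<^esub> dual_l K V l y (dual_l K V l x f)"
    proof (rule dual_space_eqI[where K = K])
      fix u assume u: "u \<in> carrier V"
      \<comment> \<open>The two minus signs of a double dual action cancel and the order of the
        actions is reversed, so the goal at \<open>u\<close> is this equation with one term moved
        across.\<close>
      have "f (l x (l y u)) = f (l (bracket x y) u) \<oplus> f (l y (l x u))"
        using rep_ll[OF x y u] by (simp add: fs cl x y u)
      then show "dual_l K V l x (dual_l K V l y f) u =
        (dual_l K V l (bracket x y) f \<oplus>\<^bsub>dual_space K V\<^esub> dual_l K V l y (dual_l K V l x f)) u"
        by (simp add: dual_defs fs cl x y u) (simp add: fs cl x y u cring_simprules)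
    qed (auto intro: dcl cl x y f)
    show "dual_l K V l x (dual_r K V l r f y) =
      dual_r K V l r (dual_l K V l x f) y \<oplus>\<^bsub>dual_space K V\<^esub> dual_r K V l r f (bracket x y)"
    proof (rule dual_space_eqI[where K = K])
      fix u assume u: "u \<in> carrier V"
      \<comment> \<open>At \<open>u\<close> the goal is -f(l y (l x u)) - f(r (l x u) y) = -f(l x (l
        y u)) - f(l x (r u y)) + f(l [x,y] u) + f(r u [x,y]): the next two equations added and
        rearranged.\<close>
      have "f (l x (l y u)) = f (l (bracket x y) u) \<oplus> f (l y (l x u))"
        using rep_ll[OF x y u] by (simp add: fs cl x y u)
      moreover have "f (l x (r u y)) = f (r (l x u) y) \<oplus> f (r u (bracket x y))"
        using rep_lr[OF x y u] by (simp add: fs cl x y u)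
      ultimately show "dual_l K V l x (dual_r K V l r f y) u =
        (dual_r K V l r (dual_l K V l x f) y \<oplus>\<^bsub>dual_space K V\<^esub>
          dual_r K V l r f (bracket x y)) u"
        by (simp add: dual_defs fs cl lin x y u) (use fs cl x y u in algebra)
    qed (auto intro: dcl cl x y f)
    show "dual_r K V l r f (bracket x y) =
      dual_r K V l r (dual_r K V l r f x) y \<oplus>\<^bsub>dual_space K V\<^esub> dual_l K V l x (dual_r K V l r f y)"
    proof (rule dual_space_eqI[where K = K])
      fix u assume u: "u \<in> carrier V"
      \<comment> \<open>The right-hand side at \<open>u\<close> has six terms besides the cancelling
        pair: four values from \<open>rep_ll\<close> and \<open>rep_lr\<close>, and the two values
        under an outer \<open>r\<close> with argument \<open>x\<close>, whose sum is shown to be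
        zero below.\<close>
      have "f (l x (l y u)) = f (l (bracket x y) u) \<oplus> f (l y (l x u))"
        using rep_ll[OF x y u] by (simp add: fs cl x y u)
      moreover have "f (l x (r u y)) = f (r (l x u) y) \<oplus> f (r u (bracket x y))"
        using rep_lr[OF x y u] by (simp add: fs cl x y u)
      moreover have "f (r (l y u) x) \<oplus> f (r (r u y) x) = \<zero>"
      proof -
        \<comment> \<open>That \<open>f\<close> kills the zero vector is obtained from homogeneity
          with the scalar zero.\<close>
        have "f (\<zero> \<odot>\<^bsub>V\<^esub> u) = \<zero>" using fs(3)[of "\<zero>" u] by (simp add: fs u)
        then have "f \<zero>\<^bsub>V\<^esub> = \<zero>" by (simp add: u)
        then show ?thesis using arg_cong[OF r_l_plus_r_r[OF x y u], of f] by (simp add: fs cl x y u)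
      qed
      ultimately show "dual_r K V l r f (bracket x y) u =
        (dual_r K V l r (dual_r K V l r f x) y \<oplus>\<^bsub>dual_space K V\<^esub>
          dual_l K V l x (dual_r K V l r f y)) u"
        by (simp add: dual_defs fs cl lin x y u) (use fs cl x y u in algebra)
    qed (auto intro: dcl cl x y f)
  qed
qed

end

section \<open>The Rota-Baxter conditions on the dual\<close>

lemma (in rota_baxter_leibniz_representation) dual_rota_baxter_leibniz_representation:
  "rota_baxter_leibniz_representation K G bracket T
    (dual_space K V) (dual_l K V l) (dual_r K V l r)
    (\<lambda>f. \<ominus>\<^bsub>dual_space K V\<^esub> dual_map V TV f)"
    (is "rota_baxter_leibniz_representation _ _ _ _ _ _ _ ?S")
proof -
  interpret D: vectorspace K "dual_space K V" by (rule V.dual_space_vectorspace)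
  note cl = bilinear_mapsD(1)[OF l_bilinear] bilinear_mapsD(1)[OF r_bilinear]
    linear_mapsD(1)[OF T_linear] linear_mapsD(1)[OF TV_linear]
  note lin = bilinear_mapsD(2-)[OF l_bilinear] bilinear_mapsD(2-)[OF r_bilinear]
    linear_mapsD(2-)[OF TV_linear]
  have S_closed: "?S f \<in> carrier (dual_space K V)" if "f \<in> carrier (dual_space K V)" for f
    using V.dual_map_closed[OF TV_linear that] by simp
  have S_apply: "?S f u = \<ominus> f (TV u)"
    if "f \<in> carrier (dual_space K V)" "u \<in> carrier V" for f u
    using V.dual_a_inv[OF V.dual_map_closed[OF TV_linear that(1)]] that(2)
    by (simp add: dual_map_def compose_def)
  note dcl = dual_l_closed dual_r_closed V.dual_add_closed V.dual_smult_closed S_closed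
  note dual_defs = dual_l_def dual_r_def dual_space_apply
  show ?thesis
  proof (intro rota_baxter_leibniz_representation.intro dual_leibniz_representation
      rota_baxter_leibniz_representation_axioms.intro rota_baxter_leibniz_algebra_axioms)
    show "?S \<in> linear_maps K (dual_space K V) (dual_space K V)"
      by (intro linear_mapsI dual_space_eqI[where K = K and V = V] dcl)
        (auto simp: S_apply dcl dual_defs cl dual_space_carrierD cring_simprules)
  next
    fix x f assume x: "x \<in> carrier G" and f: "f \<in> carrier (dual_space K V)"
    note fs = dual_space_carrierD[OF f]
    show "dual_l K V l (T x) (?S f) =
      ?S (dual_l K V l (T x) f \<oplus>\<^bsub>dual_space K V\<^esub> dual_l K V l x (?S f))"
    proof (rule dual_space_eqI[where K = K])
      fix u assume u: "u \<in> carrier V"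
      have "f (l (T x) (TV u)) = f (TV (l (T x) u)) \<oplus> f (TV (l x (TV u)))"
        using rota_baxter_l[OF x u] by (simp add: fs cl lin x u)
      then show "dual_l K V l (T x) (?S f) u =
        ?S (dual_l K V l (T x) f \<oplus>\<^bsub>dual_space K V\<^esub> dual_l K V l x (?S f)) u"
        \<comment> \<open>\<open>S_apply\<close> is used first, while \<open>dcl\<close> still
          recognises the functional under the operator as an element of the dual space; only then
          are the dual actions unfolded.\<close>
        by (simp add: S_apply dcl cl x f u)
          (simp add: dual_defs S_apply fs f cl lin x u cring_simprules)
    qed (intro dcl cl x f)+
    show "dual_r K V l r (?S f) (T x) =
      ?S (dual_r K V l r (?S f) x \<oplus>\<^bsub>dual_space K V\<^esub> dual_r K V l r f (T x))"
    proof (rule dual_space_eqI[where K = K])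
      fix u assume u: "u \<in> carrier V"
      \<comment> \<open>The value of r* at a vector contains both an l-term and an r-term, so both
        Rota-Baxter identities enter, one for each kind of term.\<close>
      have "f (l (T x) (TV u)) = f (TV (l (T x) u)) \<oplus> f (TV (l x (TV u)))"
        using rota_baxter_l[OF x u] by (simp add: fs cl lin x u)
      moreover have "f (r (TV u) (T x)) = f (TV (r (TV u) x)) \<oplus> f (TV (r u (T x)))"
        using rota_baxter_r[OF x u] by (simp add: fs cl lin x u)
      ultimately show "dual_r K V l r (?S f) (T x) u =
        ?S (dual_r K V l r (?S f) x \<oplus>\<^bsub>dual_space K V\<^esub> dual_r K V l r f (T x)) u"
        by (simp add: S_apply dcl cl x f u)
          (simp add: dual_defs S_apply fs f cl lin x u cring_simprules)
    qed (intro dcl cl x f)+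
  qed
qed

theorem proposition3p3:
  fixes K :: "('k, 'a) ring_scheme"
    and G :: "('k, 'g, 'b) module_scheme"
    and V :: "('k, 'v, 'c) module_scheme"
    and bracket :: "'g \<Rightarrow> 'g \<Rightarrow> 'g" and T :: "'g \<Rightarrow> 'g"
    and l :: "'g \<Rightarrow> 'v \<Rightarrow> 'v" and r :: "'v \<Rightarrow> 'g \<Rightarrow> 'v" and TV :: "'v \<Rightarrow> 'v"
  assumes "rota_baxter_leibniz_algebra K G bracket T"
    and "rota_baxter_leibniz_representation K G bracket T V l r TV"
  shows "rota_baxter_leibniz_representation K G bracket T
    (dual_space K V) (dual_l K V l) (dual_r K V l r)
    (\<lambda>f. \<ominus>\<^bsub>dual_space K V\<^esub> dual_map V TV f)"
  using assms(2)
  by (rule rota_baxter_leibniz_representation.dual_rota_baxter_leibniz_representation)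

end
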